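(* Let $\Sigma$ be a finite alphabet with $|\Sigma|\ge 2$ and let $d\ge 2$. Then for all sufficiently large $n$ the map $\pi_n:\mathcal{I}\to\mathcal{I}_n^{loc}$ is not onto. In particular, for such $n$ there are extreme points of $\mathcal{I}_n^{loc}$ which are not of the form $\pi_n(\mu)$ with $\mu\in\mathcal{I}$.
   Context: $\Omega=\Sigma^{\mathbb{Z}^d}$ with the product topology and the shift action $(\Theta^u x)_v=x_{u+v}$ of $\mathbb{Z}^d$; $\mathcal{I}$ is the set of $\Theta$-invariant Borel probability measures on $\Omega$. $\Lambda_n=\{-n,\ldots,n\}^d$, $\Omega_n=\Sigma^{\Lambda_n}$, $\mathcal{P}_n$ is the set of probability measures on $\Omega_n$; $\pi_n:\Omega\to\Omega_n$ is the restriction map $x\mapsto x|_{\Lambda_n}$, and $\pi_n$ also denotes the induced push-forward map on probability measures. For a finite set $E\subseteq\mathbb{Z}^d$, $a\in\Sigma^E$ and $u\in\mathbb{Z}^d$, the pattern $\Theta^u a\in\Sigma^{E-u}$ is defined by $(\Theta^u a)_v=a_{v+u}$. For $E\subseteq\Lambda_n$ and $a\in\Sigma^E$, $[a]_n=\{b\in\Omega_n : b|_E=a\}$. $\mathcal{I}_n^{loc}$ is the set of locally invariant measures, i.e. of $\mu\in\mathcal{P}_n$ such that $\mu([a]_n)=\mu([\Theta^u a]_n)$ for every $E\subseteq\Lambda_n$, every $a\in\Sigma^E$ and every $u\in\mathbb{Z}^d$ with $E-u\subseteq\Lambda_n$. One has $\pi_n(\mathcal{I})\subseteq\mathcal{I}_n^{loc}$.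 *)

theory Defs
  imports "HOL-Probability.Probability"
begin

text \<open>
  The alphabet is a finite type \<open>'s\<close> and \<open>\<int>\<^sup>d\<close> is \<open>int ^ 'd\<close> with \<open>d = CARD('d)\<close>.
  A pattern over \<open>E\<close> is an element of \<open>E \<rightarrow>\<^sub>E UNIV\<close>, so it is \<open>undefined\<close> outside \<open>E\<close>.
\<close>

definition config_topology :: "((int ^ 'd) \<Rightarrow> 's) topology" where
  "config_topology = product_topology (\<lambda>_. discrete_topology UNIV) UNIV"

definition config_borel :: "((int ^ 'd) \<Rightarrow> 's) measure" where
  "config_borel = sigma UNIV {U. openin config_topology U}"

definition shift :: "int ^ 'd \<Rightarrow> ((int ^ 'd) \<Rightarrow> 's) \<Rightarrow> ((int ^ 'd) \<Rightarrow> 's)" where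
  "shift u x = (\<lambda>v. x (u + v))"

definition invariant_measures :: "((int ^ 'd) \<Rightarrow> 's) measure set" where
  "invariant_measures =
    {\<mu>. prob_space \<mu> \<and> sets \<mu> = sets config_borel \<and>
        (\<forall>u. distr \<mu> config_borel (shift u) = \<mu>)}"

definition cube :: "nat \<Rightarrow> (int ^ 'd) set" where
  "cube n = {v. \<forall>i. v $ i \<in> {- int n..int n}}"

definition patterns :: "(int ^ 'd) set \<Rightarrow> ((int ^ 'd) \<Rightarrow> 's) set" where
  "patterns E = E \<rightarrow>\<^sub>E UNIV"

definition prob_measures :: "nat \<Rightarrow> ((int ^ 'd) \<Rightarrow> 's) measure set" where
  "prob_measures n = {\<mu>. prob_space \<mu> \<and> sets \<mu> = Pow (patterns (cube n))}"

definition marginal ::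
    "nat \<Rightarrow> ((int ^ 'd) \<Rightarrow> 's) measure \<Rightarrow> ((int ^ 'd) \<Rightarrow> 's) measure" where
  "marginal n \<mu> =
    distr \<mu> (count_space (patterns (cube n))) (\<lambda>x. restrict x (cube n))"

definition translate :: "(int ^ 'd) set \<Rightarrow> int ^ 'd \<Rightarrow> (int ^ 'd) set" where
  "translate E u = (\<lambda>v. v - u) ` E"

definition shift_pattern ::
    "(int ^ 'd) set \<Rightarrow> int ^ 'd \<Rightarrow> ((int ^ 'd) \<Rightarrow> 's) \<Rightarrow> ((int ^ 'd) \<Rightarrow> 's)" where
  "shift_pattern E u a = restrict (\<lambda>v. a (v + u)) (translate E u)"

definition cylinder ::
    "nat \<Rightarrow> (int ^ 'd) set \<Rightarrow> ((int ^ 'd) \<Rightarrow> 's) \<Rightarrow> ((int ^ 'd) \<Rightarrow> 's) set" where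
  "cylinder n E a = {b \<in> patterns (cube n). restrict b E = a}"

definition locally_invariant_measures :: "nat \<Rightarrow> ((int ^ 'd) \<Rightarrow> 's) measure set" where
  "locally_invariant_measures n =
    {\<mu> \<in> prob_measures n.
      \<forall>E a u. E \<subseteq> cube n \<longrightarrow> a \<in> patterns E \<longrightarrow> translate E u \<subseteq> cube n \<longrightarrow>
        measure \<mu> (cylinder n E a) =
        measure \<mu> (cylinder n (translate E u) (shift_pattern E u a))}"

text \<open>
  The type of measures is not a real vector space, so \<open>extreme_point_of\<close> does not apply
  to sets of measures.
\<close>

definition extreme_measure :: "'a measure \<Rightarrow> 'a measure set \<Rightarrow> bool" where
  "extreme_measure \<mu> K \<longleftrightarrow>
    \<mu> \<in> K \<and>
    (\<forall>\<mu>\<^sub>1\<in>K. \<forall>\<mu>\<^sub>2\<in>K. \<forall>t. 0 < t \<longrightarrow> t < 1 \<longrightarrow>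
      (\<forall>A\<in>sets \<mu>. measure \<mu> A = (1 - t) * measure \<mu>\<^sub>1 A + t * measure \<mu>\<^sub>2 A) \<longrightarrow>
      \<mu>\<^sub>1 = \<mu>\<^sub>2)"

end

theory Submission
  imports Defs "HOL-Real_Asymp.Real_Asymp"
begin

text \<open>
  A face of the polytope of locally invariant measures consists of the measures supported on
  the patterns of a fixed configuration \<open>x\<close>. It is nonempty, and a measure of minimal support in
  it is extreme and has rational weights, because its weights are the unique solution of
  a linear system with integer coefficients. So it suffices to find \<open>x\<close> such that, whenever the
  patterns of an invariant measure occur in \<open>x\<close>, some event has irrational probability.

  As in Kari's aperiodic tilings, the rows of \<open>x\<close> in a coordinate plane are Beatty sequences whose
  densities are multiplied by \<open>2\<close> or by \<open>1/3\<close> from each row to the next, and these factors are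
  enforced by a rule of finite range. Densities stay between two positive constants, so the
  frequency \<open>p\<close> of doublings satisfies \<open>p ln 2 = (1 - p) ln 3\<close> and is irrational.
\<close>

section \<open>Rows with multiplying densities\<close>

definition window_sum :: "(int \<Rightarrow> int) \<Rightarrow> int \<Rightarrow> nat \<Rightarrow> int" where
  "window_sum a i k = (\<Sum>t<k. a (i + int t))"

text \<open>
  If \<open>b\<close> keeps every \<open>q\<close>-th one of \<open>a\<close>, then \<open>excess\<close> is the number of ones of \<open>a\<close> that are
  passed before the next kept one. It is computed in a window of fixed length, so
  \<open>thins\<close> is a local condition.
\<close>

definition excess :: "int \<Rightarrow> (int \<Rightarrow> int) \<Rightarrow> (int \<Rightarrow> int) \<Rightarrow> int \<Rightarrow> int" where
  "excess q a b i = Max ((\<lambda>k. window_sum a i k - q * window_sum b i k) ` {..12})"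

definition thins :: "int \<Rightarrow> (int \<Rightarrow> int) \<Rightarrow> (int \<Rightarrow> int) \<Rightarrow> int \<Rightarrow> bool" where
  "thins q a b i \<longleftrightarrow> excess q a b (i + 1) = excess q a b i - a i + q * b i"

text \<open>The factor between two rows is read off locally, by counting ones in windows of length
  12. For Beatty rows of slope at least 1/6 this length suffices to tell doubling from division by
  3.\<close>

definition growing :: "(int \<Rightarrow> int \<Rightarrow> int) \<Rightarrow> int \<Rightarrow> int \<Rightarrow> bool" where
  "growing Y j i \<longleftrightarrow> window_sum (Y j) i 12 < window_sum (Y (j + 1)) i 12"

text \<open>Doubling is expressed through its inverse: row \<open>j\<close> keeps every second one
  of row \<open>j + 1\<close>. The first conjunct makes a whole row choose a single factor. The
  second bounds its density below by 1/12, which together with the upper bound 1 keeps products of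
  the factors bounded.\<close>

definition admissible :: "(int \<Rightarrow> int \<Rightarrow> int) \<Rightarrow> int \<Rightarrow> int \<Rightarrow> bool" where
  "admissible Y j i \<longleftrightarrow>
    (growing Y j (i + 1) \<longleftrightarrow> growing Y j i) \<and> 1 \<le> window_sum (Y j) i 12 \<and>
    (if growing Y j i then thins 2 (Y (j + 1)) (Y j) i else thins 3 (Y j) (Y (j + 1)) i)"

section \<open>Locality of the row rule\<close>

lemma window_sum_cong:
  assumes "\<And>t. t < k \<Longrightarrow> a (i + int t) = a' (i' + int t)"
  shows "window_sum a i k = window_sum a' i' k"
  unfolding window_sum_def using assms by (intro sum.cong) auto

lemma excess_cong:
  assumes "\<And>t. t < 12 \<Longrightarrow> a (i + int t) = a' (i' + int t)"
    and "\<And>t. t < 12 \<Longrightarrow> b (i + int t) = b' (i' + int t)"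
  shows "excess q a b i = excess q a' b' i'"
proof -
  have "window_sum a i k - q * window_sum b i k = window_sum a' i' k - q * window_sum b' i' k"
    if "k \<in> {..12}" for k
  proof -
    have "window_sum a i k = window_sum a' i' k" "window_sum b i k = window_sum b' i' k"
      using that assms by (auto intro!: window_sum_cong)
    then show ?thesis by simp
  qed
  then show ?thesis unfolding excess_def by (metis (no_types, lifting) image_cong)
qed

lemma growing_cong:
  assumes "\<And>t. t < 12 \<Longrightarrow> Y j (i + int t) = Y' j' (i' + int t)"
    and "\<And>t. t < 12 \<Longrightarrow> Y (j + 1) (i + int t) = Y' (j' + 1) (i' + int t)"
  shows "growing Y j i \<longleftrightarrow> growing Y' j' i'"
proof -
  have "window_sum (Y j) i 12 = window_sum (Y' j') i' 12"
    "window_sum (Y (j + 1)) i 12 = window_sum (Y' (j' + 1)) i' 12"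
    using assms by (auto intro!: window_sum_cong)
  then show ?thesis by (simp add: growing_def)
qed

text \<open>The rule sees two rows and 13 columns: windows have length 12, and \<open>thins\<close>
  and the first conjunct of \<open>admissible\<close> also look at the window starting at
  \<open>i + 1\<close>.\<close>

lemma admissible_cong:
  assumes "\<And>t. t \<le> 12 \<Longrightarrow> Y j (i + int t) = Y' j' (i' + int t)"
    and "\<And>t. t \<le> 12 \<Longrightarrow> Y (j + 1) (i + int t) = Y' (j' + 1) (i' + int t)"
  shows "admissible Y j i \<longleftrightarrow> admissible Y' j' i'"
proof -
  have next1: "Y j (i + 1 + int t) = Y' j' (i' + 1 + int t)" if "t < 12" for t
    using assms(1)[of "Suc t"] that by (simp add: add.assoc)
  have next2: "Y (j + 1) (i + 1 + int t) = Y' (j' + 1) (i' + 1 + int t)" if "t < 12" for t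
    using assms(2)[of "Suc t"] that by (simp add: add.assoc)
  have cells: "Y j i = Y' j' i'" "Y (j + 1) i = Y' (j' + 1) i'"
    using assms(1)[of 0] assms(2)[of 0] by auto
  have "growing Y j i \<longleftrightarrow> growing Y' j' i'" "growing Y j (i + 1) \<longleftrightarrow> growing Y' j' (i' + 1)"
    using assms next1 next2 by (auto intro!: growing_cong)
  moreover have "window_sum (Y j) i 12 = window_sum (Y' j') i' 12"
    using assms(1) by (intro window_sum_cong) auto
  moreover have "thins 2 (Y (j + 1)) (Y j) i \<longleftrightarrow> thins 2 (Y' (j' + 1)) (Y' j') i'"
    "thins 3 (Y j) (Y (j + 1)) i \<longleftrightarrow> thins 3 (Y' j') (Y' (j' + 1)) i'"
    unfolding thins_def cells
    using assms next1 next2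
      excess_cong[of "Y (j + 1)" i "Y' (j' + 1)" i' "Y j" "Y' j'" 2]
      excess_cong[of "Y (j + 1)" "i + 1" "Y' (j' + 1)" "i' + 1" "Y j" "Y' j'" 2]
      excess_cong[of "Y j" i "Y' j'" i' "Y (j + 1)" "Y' (j' + 1)" 3]
      excess_cong[of "Y j" "i + 1" "Y' j'" "i' + 1" "Y (j + 1)" "Y' (j' + 1)" 3]
    by auto
  ultimately show ?thesis unfolding admissible_def by simp
qed

section \<open>Densities in consecutive admissible rows\<close>

lemma window_sum_add: "window_sum a i (k + l) = window_sum a i k + window_sum a (i + int k) l"
proof (induction l)
  case (Suc l)
  then show ?case by (simp add: window_sum_def algebra_simps)
qed (simp add: window_sum_def)

lemma window_sum_bounds:
  assumes "\<And>i. a i \<in> {0..1}"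
  shows "0 \<le> window_sum a i k" "window_sum a i k \<le> int k"
proof -
  show "0 \<le> window_sum a i k"
    unfolding window_sum_def using assms by (intro sum_nonneg) auto
  have "window_sum a i k \<le> (\<Sum>t<k. 1)"
    unfolding window_sum_def using assms by (intro sum_mono) auto
  then show "window_sum a i k \<le> int k" by simp
qed

lemma excess_bounds:
  assumes a: "\<And>i. a i \<in> {0..1}" and b: "\<And>i. b i \<in> {0..1}" and "0 \<le> q"
  shows "0 \<le> excess q a b i" "excess q a b i \<le> 12"
proof -
  show "0 \<le> excess q a b i"
    unfolding excess_def by (rule Max_ge) (auto simp: window_sum_def intro!: image_eqI[of _ _ 0])
  have "window_sum a i k - q * window_sum b i k \<le> 12" if "k \<le> 12" for k
    using window_sum_bounds[of a, OF a, of i k]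
      mult_nonneg_nonneg[OF \<open>0 \<le> q\<close> window_sum_bounds(1)[of b, OF b, of i k]] that by linarith
  then show "excess q a b i \<le> 12"
    unfolding excess_def by (subst Max_le_iff) auto
qed

text \<open>The identities \<open>thins q a b i\<close> telescope: over \<open>k\<close> cells the
  difference of the two counts is a difference of two values of \<open>excess\<close>, each between
  0 and 12.\<close>

lemma thins_window_sum:
  assumes a: "\<And>i. a i \<in> {0..1}" and b: "\<And>i. b i \<in> {0..1}" and "0 \<le> q"
    and thins: "\<And>i. thins q a b i"
  shows "\<bar>window_sum a i k - q * window_sum b i k\<bar> \<le> 12"
proof -
  have "excess q a b (i + int k) = excess q a b i - window_sum a i k + q * window_sum b i k"
  proof (induction k)
    case (Suc k)
    have "excess q a b (i + int (Suc k)) =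
        excess q a b (i + int k) - a (i + int k) + q * b (i + int k)"
      using thins[of "i + int k"] by (simp add: thins_def algebra_simps)
    with Suc show ?case by (simp add: window_sum_def algebra_simps)
  qed (simp add: window_sum_def)
  with excess_bounds[of a b, OF a b \<open>0 \<le> q\<close>, of i] excess_bounds[of a b, OF a b \<open>0 \<le> q\<close>, of "i + int k"]
  show ?thesis by linarith
qed

definition growth :: "(int \<Rightarrow> int \<Rightarrow> int) \<Rightarrow> int \<Rightarrow> real" where
  "growth Y j = (if growing Y j 0 then 2 else 1 / 3)"

lemma growing_row:
  assumes "\<And>i. admissible Y j i"
  shows "growing Y j i \<longleftrightarrow> growing Y j 0"
proof (induction i rule: int_induct[of _ 0])
  case (step1 i)
  then show ?case using assms[of i] by (simp add: admissible_def)
next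
  case (step2 i)
  then show ?case using assms[of "i - 1"] by (simp add: admissible_def)
qed simp

text \<open>In a growing row the bound is that of \<open>thins_window_sum\<close>. Otherwise the
  estimate is divided by 3, which only improves the error 12.\<close>

lemma window_sum_growth:
  assumes Y: "\<And>j i. Y j i \<in> {0..1}" and adm: "\<And>i. admissible Y j i"
  shows "\<bar>window_sum (Y (j + 1)) 0 k - growth Y j * window_sum (Y j) 0 k\<bar> \<le> 12"
proof (cases "growing Y j 0")
  case True
  then have "thins 2 (Y (j + 1)) (Y j) i" for i
    using adm[of i] growing_row[OF adm, of i] by (simp add: admissible_def)
  then have "\<bar>window_sum (Y (j + 1)) 0 k - 2 * window_sum (Y j) 0 k\<bar> \<le> 12"
    using Y by (intro thins_window_sum) auto
  with True show ?thesis by (simp add: growth_def)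
next
  case False
  then have "thins 3 (Y j) (Y (j + 1)) i" for i
    using adm[of i] growing_row[OF adm, of i] by (simp add: admissible_def)
  then have "\<bar>window_sum (Y j) 0 k - 3 * window_sum (Y (j + 1)) 0 k\<bar> \<le> 12"
    using Y by (intro thins_window_sum) auto
  with False show ?thesis by (simp add: growth_def)
qed

text \<open>An additive error does not affect the comparison of slopes. This turns estimates up to a
  constant into exact inequalities between densities and, with \<open>b = 0\<close>, forces an
  average to vanish.\<close>

lemma linear_le_imp_le:
  fixes a b c :: real
  assumes "\<And>k::nat. a * k \<le> b * k + c"
  shows "a \<le> b"
proof (rule ccontr)
  assume "\<not> a \<le> b"
  then obtain k :: nat where "c / (a - b) < k" using reals_Archimedean2 by blast
  with \<open>\<not> a \<le> b\<close> have "c < k * (a - b)" by (simp add: divide_less_eq)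
  with assms[of k] show False by (simp add: algebra_simps)
qed

text \<open>
  Every row has density between \<open>1/12\<close> and \<open>1\<close>, and passing from row \<open>j\<close> to row \<open>j + 1\<close>
  multiplies the density by \<open>growth Y j\<close>.
\<close>

lemma prod_growth_bounds:
  assumes Y: "\<And>j i. Y j i \<in> {0..1}" and adm: "\<And>j i. admissible Y j i"
  shows "(\<Prod>j<K. growth Y (int j)) \<in> {1/12..12}"
proof -
  define P where "P K = (\<Prod>j<K. growth Y (int j))" for K :: nat
  have growth: "0 < growth Y j" "growth Y j \<le> 2" for j by (auto simp: growth_def)
  \<comment> \<open>The error \<open>C\<close> may depend on \<open>K\<close> but not on
    \<open>k\<close>, which is enough to compare densities for fixed \<open>K\<close>. One more row
    turns it into \<open>12 + 2 * C\<close>: the old error is multiplied by at most 2, and a new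
    error of at most 12 is added.\<close>
  have "\<exists>C. \<forall>k. \<bar>window_sum (Y (int K)) 0 k - P K * window_sum (Y 0) 0 k\<bar> \<le> C" for K
  proof (induction K)
    case 0
    show ?case by (rule exI[of _ 0]) (simp add: P_def)
  next
    case (Suc K)
    then obtain C where
      C: "\<And>k. \<bar>window_sum (Y (int K)) 0 k - P K * window_sum (Y 0) 0 k\<bar> \<le> C" by blast
    have "\<bar>window_sum (Y (int (Suc K))) 0 k - P (Suc K) * window_sum (Y 0) 0 k\<bar> \<le> 12 + 2 * C" for k
    proof -
      let ?g = "growth Y (int K)"
      let ?d = "window_sum (Y (int K)) 0 k - P K * window_sum (Y 0) 0 k"
      have "window_sum (Y (int (Suc K))) 0 k - P (Suc K) * window_sum (Y 0) 0 k =
          (window_sum (Y (int K + 1)) 0 k - ?g * window_sum (Y (int K)) 0 k) + ?g * ?d"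
        by (simp add: P_def algebra_simps)
      moreover have "\<bar>window_sum (Y (int K + 1)) 0 k - ?g * window_sum (Y (int K)) 0 k\<bar> \<le> 12"
        by (rule window_sum_growth[OF Y adm])
      moreover have "\<bar>?g * ?d\<bar> \<le> 2 * C"
        unfolding abs_mult using growth[of "int K"] C[of k] by (intro mult_mono) auto
      ultimately show ?thesis by linarith
    qed
    then show ?case by blast
  qed
  then obtain C where C: "\<And>k. \<bar>window_sum (Y (int K)) 0 k - P K * window_sum (Y 0) 0 k\<bar> \<le> C"
    by blast
  \<comment> \<open>The first \<open>12 * k\<close> cells split into \<open>k\<close> windows of
    length 12, and admissibility puts a one into each of them.\<close>
  have lower: "int k \<le> window_sum (Y j) 0 (12 * k)" for j k
  proof (induction k)
    case (Suc k)
    have "window_sum (Y j) 0 (12 * k + 12) =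
        window_sum (Y j) 0 (12 * k) + window_sum (Y j) (int (12 * k)) 12"
      by (simp add: window_sum_add)
    with Suc adm[of j "int (12 * k)"] show ?case by (simp add: admissible_def add.commute)
  qed (simp add: window_sum_def)
  have "0 < P K" unfolding P_def using growth by (intro prod_pos) auto
  have lower': "real k \<le> window_sum (Y j) 0 (12 * k)" for j k
    using lower[of k j] by (metis of_int_le_iff of_int_of_nat_eq)
  have upper: "window_sum (Y j) 0 (12 * k) \<le> 12 * real k" for j k
  proof -
    have "window_sum (Y j) 0 (12 * k) \<le> int (12 * k)" using Y by (rule window_sum_bounds)
    then have "real_of_int (window_sum (Y j) 0 (12 * k)) \<le> real_of_int (int (12 * k))"
      by (simp only: of_int_le_iff)
    then show ?thesis by simp
  qed
  have "P K * real k \<le> 12 * real k + C" for k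
  proof -
    have "P K * real k \<le> P K * window_sum (Y 0) 0 (12 * k)"
      using lower'[of k 0] \<open>0 < P K\<close> by (intro mult_left_mono) auto
    with C[of "12 * k"] upper[of "int K" k] show ?thesis by linarith
  qed
  then have "P K \<le> 12" by (rule linear_le_imp_le)
  moreover have "1 * real k \<le> (12 * P K) * real k + C" for k
  proof -
    have "P K * window_sum (Y 0) 0 (12 * k) \<le> P K * (12 * real k)"
      using upper[of 0 k] \<open>0 < P K\<close> by (intro mult_left_mono) auto
    also have "\<dots> = (12 * P K) * real k" by simp
    finally show ?thesis using C[of "12 * k"] lower'[of k "int K"] by linarith
  qed
  then have "1 \<le> 12 * P K" by (rule linear_le_imp_le)
  ultimately show ?thesis by (simp add: P_def)
qed

text \<open>This is \<open>prod_growth_bounds\<close> after taking logarithms: a growing row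
  contributes \<open>ln 2\<close>, any other row \<open>- ln 3\<close>.\<close>

lemma card_growing_bound:
  assumes Y: "\<And>j i. Y j i \<in> {0..1}" and adm: "\<And>j i. admissible Y j i"
  shows "\<bar>(\<Sum>j<K. of_bool (growing Y (int j) 0)) * (ln 2 + ln 3) - real K * ln 3\<bar> \<le> ln 12"
proof -
  have *: "ln (growth Y j) = of_bool (growing Y j 0) * (ln 2 + ln 3) - ln 3" for j
    by (simp add: growth_def ln_div)
  have "ln (\<Prod>j<K. growth Y (int j)) = (\<Sum>j<K. ln (growth Y (int j)))"
    by (intro ln_prod) (auto simp: growth_def)
  also have "\<dots> = (\<Sum>j<K. of_bool (growing Y (int j) 0)) * (ln 2 + ln 3) - real K * ln 3"
    unfolding * by (simp add: sum_subtractf sum_distrib_right)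
  finally have "\<dots> = ln (\<Prod>j<K. growth Y (int j))" ..
  moreover have "ln (1 / 12) \<le> ln (\<Prod>j<K. growth Y (int j))"
    "ln (\<Prod>j<K. growth Y (int j)) \<le> ln 12"
    using prod_growth_bounds[OF Y adm, of K] by (auto intro!: ln_mono)
  ultimately show ?thesis by (simp add: ln_div)
qed

section \<open>Beatty rows satisfying the rule\<close>

text \<open>
  The orbit \<open>6 powr frac (j * log 6 2) / 6\<close> is a rotation in logarithmic coordinates; it turns
  by \<open>log 6 2\<close> when the value doubles and by \<open>log 6 2 - 1 = log 6 (1/3)\<close> otherwise.
\<close>

lemma ex_orbit:
  "\<exists>r :: int \<Rightarrow> real. \<forall>j. 1/6 \<le> r j \<and> r j < 1 \<and> (r (j + 1) = 2 * r j \<or> r (j + 1) = r j / 3)"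
proof (intro exI allI)
  fix j :: int
  define \<alpha> :: real where "\<alpha> = log 6 2"
  let ?r = "\<lambda>j :: int. 6 powr (frac (real_of_int j * \<alpha>) - 1)"
  have \<alpha>: "6 powr \<alpha> = (2::real)" "0 < \<alpha>" "\<alpha> < 1" by (auto simp: \<alpha>_def)
  have "6 powr (-1) \<le> ?r j" by (rule powr_mono) auto
  moreover have "?r j < 6 powr 0" using frac_lt_1[of "real_of_int j * \<alpha>"] by (intro powr_less_mono) auto
  moreover have "?r (j + 1) = 2 * ?r j \<or> ?r (j + 1) = ?r j / 3"
  proof -
    \<comment> \<open>The second alternative is a carry. It costs an extra factor 1/6, and 2/6 =
      1/3.\<close>
    have "frac (real_of_int (j + 1) * \<alpha>) = frac (real_of_int j * \<alpha>) + \<alpha> \<or>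
        frac (real_of_int (j + 1) * \<alpha>) = frac (real_of_int j * \<alpha>) + \<alpha> - 1"
      using \<alpha> frac_add[of "real_of_int j * \<alpha>" \<alpha>] by (auto simp: algebra_simps frac_eq[THEN iffD2] split: if_splits)
    then show ?thesis
    proof
      assume "frac (real_of_int (j + 1) * \<alpha>) = frac (real_of_int j * \<alpha>) + \<alpha>"
      then have "?r (j + 1) = 6 powr \<alpha> * ?r j" by (simp add: powr_add[symmetric] algebra_simps)
      with \<alpha> show ?thesis by simp
    next
      assume "frac (real_of_int (j + 1) * \<alpha>) = frac (real_of_int j * \<alpha>) + \<alpha> - 1"
      then have "frac (real_of_int (j + 1) * \<alpha>) - 1 = \<alpha> + -1 + (frac (real_of_int j * \<alpha>) - 1)"
        by linarith
      then have "?r (j + 1) = 6 powr (\<alpha> + -1 + (frac (real_of_int j * \<alpha>) - 1))"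
        by (rule arg_cong)
      also have "\<dots> = 6 powr \<alpha> * 6 powr (-1) * ?r j" by (simp only: powr_add)
      finally show ?thesis using \<alpha> by (simp add: powr_minus)
    qed
  qed
  ultimately show "1/6 \<le> ?r j \<and> ?r j < 1 \<and> (?r (j + 1) = 2 * ?r j \<or> ?r (j + 1) = ?r j / 3)"
    by (simp add: powr_minus)
qed

text \<open>The lower mechanical word of slope \<open>r\<close>: its sums telescope, so the number
  of ones in any window is a difference of two floors.\<close>

definition beatty :: "real \<Rightarrow> int \<Rightarrow> int" where
  "beatty r i = \<lfloor>(i + 1) * r\<rfloor> - \<lfloor>i * r\<rfloor>"

lemma beatty_01: "0 \<le> r \<Longrightarrow> r < 1 \<Longrightarrow> beatty r i \<in> {0..1}"
  unfolding beatty_def atLeastAtMost_iff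
  by (simp add: algebra_simps) linarith

lemma window_sum_beatty: "window_sum (beatty r) i k = \<lfloor>real_of_int (i + int k) * r\<rfloor> - \<lfloor>i * r\<rfloor>"
  by (induction k) (auto simp: window_sum_def beatty_def algebra_simps)

lemma window_sum_beatty_approx:
  fixes r :: real
  shows "\<bar>window_sum (beatty r) i k - k * r\<bar> < 1"
proof -
  have "real_of_int (i + int k) * r = i * r + k * r" by (simp add: algebra_simps)
  then show ?thesis unfolding window_sum_beatty by linarith
qed

text \<open>\<open>\<lfloor>i r / q\<rfloor> = \<lfloor>i r\<rfloor> div q\<close>: dividing the slope by \<open>q\<close> keeps every \<open>q\<close>-th one.\<close>

lemma thins_beatty:
  assumes r: "1/6 \<le> r" "r < 1" and q: "q \<in> {2, 3}"
  shows "thins q (beatty r) (beatty (r / q)) i"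
proof -
  define s where "s i = \<lfloor>real_of_int i * r\<rfloor>" for i :: int
  have div: "\<lfloor>real_of_int i * (r / q)\<rfloor> = s i div q" for i
    using floor_divide_real_eq_div[of q "real_of_int i * r"] q by (auto simp: s_def)
  \<comment> \<open>By \<open>div\<close>, the quantity maximised in \<open>excess\<close> becomes a
    difference of residues modulo \<open>q\<close>.\<close>
  have diff: "window_sum (beatty r) i k - q * window_sum (beatty (r / q)) i k =
      s (i + int k) mod q - s i mod q" for i k
  proof -
    have "window_sum (beatty r) i k = s (i + int k) - s i"
      by (simp only: window_sum_beatty s_def)
    moreover have "q * window_sum (beatty (r / q)) i k = q * (s (i + int k) div q) - q * (s i div q)"
      by (simp only: window_sum_beatty div right_diff_distrib)
    ultimately show ?thesis
      using mult_div_mod_eq[of q "s (i + int k)"] mult_div_mod_eq[of q "s i"] by linarith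
  qed
  have step: "s (i + 1) \<in> {s i, s i + 1}" for i
    using beatty_01[of r i] r by (auto simp: beatty_def s_def)
  have six: "s i + 1 \<le> s (i + 6)" for i
  proof -
    have "real_of_int (i + 6) * r = i * r + 6 * r" by (simp add: algebra_simps)
    with r show ?thesis unfolding s_def by linarith
  qed
  \<comment> \<open>The residue \<open>q - 1\<close> is at most two increments ahead, because
    \<open>q\<close> is at most 3, and 12 cells contain at least two increments by
    \<open>six\<close>. Since \<open>s\<close> moves by 0 or 1, it skips no value on the
    way.\<close>
  have visit: "\<exists>k\<le>12. s (i + int k) mod q = q - 1" for i
  proof -
    have "\<exists>k\<le>12. s (i + int k) = s i + c" if "c \<in> {0..2}" for c
    proof -
      have "s i + 2 \<le> s (i + 12)" using six[of i] six[of "i + 6"] by (simp add: add.assoc)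
      \<comment> \<open>A discrete intermediate value argument: the first position reaching
        \<open>s i + c\<close> cannot overshoot it.\<close>
      define k where "k = (LEAST k. s i + c \<le> s (i + int k))"
      have ex: "s i + c \<le> s (i + int 12)" using \<open>s i + 2 \<le> s (i + 12)\<close> that by auto
      have k: "s i + c \<le> s (i + int k)" "k \<le> 12"
        unfolding k_def using ex by (rule LeastI, rule Least_le)
      have "s (i + int k) \<le> s i + c"
      proof (cases k)
        case 0
        have "0 \<le> c" using that by simp
        with 0 show ?thesis by simp
      next
        case (Suc l)
        then have "l < k" by simp
        then have "\<not> s i + c \<le> s (i + int l)" unfolding k_def by (rule not_less_Least)
        with step[of "i + int l"] Suc show ?thesis by (auto simp: algebra_simps)
      qed
      with k show ?thesis by (intro exI[of _ k]) auto
    qed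
    moreover have "\<exists>c\<in>{0..2}. (s i + c) mod q = q - 1"
    proof (rule bexI[of _ "q - 1 - s i mod q"])
      have "0 \<le> s i mod q" "s i mod q < q" "q \<le> 3"
        using q by (auto intro: pos_mod_sign pos_mod_bound)
      then show "q - 1 - s i mod q \<in> {0..2}" by simp
      have "s i + (q - 1 - s i mod q) = (q - 1) + q * (s i div q)"
        using mult_div_mod_eq[of q "s i"] by linarith
      then have "(s i + (q - 1 - s i mod q)) mod q = (q - 1) mod q" by (simp only: mod_mult_self2)
      also have "\<dots> = q - 1" using q by auto
      finally show "(s i + (q - 1 - s i mod q)) mod q = q - 1" .
    qed
    ultimately obtain c k where "(s i + c) mod q = q - 1" "k \<le> 12" "s (i + int k) = s i + c"
      by blast
    then show ?thesis by (intro exI[of _ k]) auto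
  qed
  have excess: "excess q (beatty r) (beatty (r / q)) i = q - 1 - s i mod q" for i
    unfolding excess_def diff
  proof (rule Max_eqI)
    fix y assume "y \<in> (\<lambda>k. s (i + int k) mod q - s i mod q) ` {..12}"
    then obtain k where "y = s (i + int k) mod q - s i mod q" by blast
    moreover have "s (i + int k) mod q < q" using q by (intro pos_mod_bound) auto
    ultimately show "y \<le> q - 1 - s i mod q" by linarith
  next
    obtain k where "k \<le> 12" "s (i + int k) mod q = q - 1" using visit by blast
    then show "q - 1 - s i mod q \<in> (\<lambda>k. s (i + int k) mod q - s i mod q) ` {..12}"
      by (intro image_eqI[of _ _ k]) auto
  qed auto
  show ?thesis
    using diff[of i 1] by (simp add: thins_def excess window_sum_def)
qed

lemma admissible_beatty:
  fixes r :: "int \<Rightarrow> real"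
  assumes r: "\<And>j. 1/6 \<le> r j" "\<And>j. r j < 1" and step: "\<And>j. r (j + 1) = 2 * r j \<or> r (j + 1) = r j / 3"
  shows "admissible (\<lambda>j. beatty (r j)) j i"
proof -
  \<comment> \<open>Each count is within 1 of 12 times its slope. For slope at least 1/6, doubling
    raises 12 times the slope by at least 2, so the count strictly increases. After division by 3
    the counts satisfy new - old < 2 - 8/6 < 1, so there is no increase.\<close>
  have growing: "growing (\<lambda>j. beatty (r j)) j i \<longleftrightarrow> r (j + 1) = 2 * r j" for i
    using window_sum_beatty_approx[of "r j" i 12] window_sum_beatty_approx[of "r (j + 1)" i 12]
      r(1)[of j] step[of j] unfolding growing_def by auto
  have "1 \<le> window_sum (beatty (r j)) i 12"
    using window_sum_beatty_approx[of "r j" i 12] r(1)[of j] by linarith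
  \<comment> \<open>Here the rows exchange roles: \<open>r j\<close> is
    \<open>r (j + 1) / 2\<close>, so row \<open>j + 1\<close> is the one being thinned.\<close>
  moreover have "thins 2 (beatty (r (j + 1))) (beatty (r j)) i" if "r (j + 1) = 2 * r j"
    using thins_beatty[of "r (j + 1)" 2 i] r[of "j + 1"] that by simp
  moreover have "thins 3 (beatty (r j)) (beatty (r (j + 1))) i" if "r (j + 1) = r j / 3"
    unfolding that using thins_beatty[of "r j" 3 i] r[of j] by simp
  ultimately show ?thesis using step[of j] unfolding admissible_def growing by auto
qed

lemma ex_admissible_array:
  "\<exists>Y. (\<forall>j i. Y j i \<in> {0..1}) \<and> (\<forall>j i. admissible Y j i)"
proof -
  obtain r :: "int \<Rightarrow> real" where r: "\<And>j. 1/6 \<le> r j" "\<And>j. r j < 1"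
    and step: "\<And>j. r (j + 1) = 2 * r j \<or> r (j + 1) = r j / 3"
    using ex_orbit by blast
  have "0 \<le> r j" for j using r(1)[of j] by linarith
  then have "beatty (r j) i \<in> {0..1}" for j i using r by (intro beatty_01) auto
  moreover have "admissible (\<lambda>j. beatty (r j)) j i" for j i
    using r step by (rule admissible_beatty)
  ultimately show ?thesis by (intro exI[of _ "\<lambda>j. beatty (r j)"]) auto
qed

text \<open>A fraction \<open>p = m / n\<close> would give 2^m = 3^(n - m) with m > 0, an even
  number equal to an odd one.\<close>

lemma growing_frequency_irrational:
  fixes p :: real
  assumes "p * (ln 2 + ln 3) = ln 3"
  shows "p \<notin> \<rat>"
proof
  assume "p \<in> \<rat>"
  have "p = ln 3 / (ln 2 + ln 3)" using assms add_pos_pos[of "ln 2 :: real" "ln 3"] by (simp add: eq_divide_eq)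
  then have "0 < p" "p < 1" by (simp_all add: add_pos_pos divide_less_eq)
  obtain m n :: nat where n: "n \<noteq> 0" and p: "p = real m / real n"
    using Rats_abs_nat_div_natE[OF \<open>p \<in> \<rat>\<close>] \<open>0 < p\<close> by (metis abs_of_pos)
  have "m < n" "0 < m" using p n \<open>0 < p\<close> \<open>p < 1\<close> by (auto simp: divide_less_eq zero_less_divide_iff)
  have "real m * (ln 2 + ln 3) = real n * ln 3" using assms n by (simp add: p field_simps)
  then have "real m * ln 2 = real (n - m) * ln 3"
    using \<open>m < n\<close> by (simp add: of_nat_diff algebra_simps)
  then have "ln (2 ^ m :: real) = ln (3 ^ (n - m))" by (simp add: ln_realpow)
  then have "(2 ^ m :: real) = 3 ^ (n - m)" by (subst (asm) ln_inj_iff) auto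
  then have "real (2 ^ m) = real (3 ^ (n - m))" by simp
  then have "(2 ^ m :: nat) = 3 ^ (n - m)" by (simp only: of_nat_eq_iff)
  moreover have "even (2 ^ m :: nat)" using \<open>0 < m\<close> by simp
  moreover have "odd (3 ^ (n - m) :: nat)" by simp
  ultimately show False by metis
qed

section \<open>Rational extreme points\<close>

lemma finite_card_vec_box:
  fixes A :: "'a set"
  assumes "finite A"
  shows "finite {v :: 'a ^ 'd::finite. \<forall>i. v $ i \<in> A}"
    and "card {v :: 'a ^ 'd. \<forall>i. v $ i \<in> A} = card A ^ CARD('d)"
proof -
  have bij: "bij_betw vec_nth {v :: 'a ^ 'd. \<forall>i. v $ i \<in> A} (UNIV \<rightarrow>\<^sub>E A)"
    by (rule bij_betwI[of _ _ _ vec_lambda]) (auto simp: PiE_UNIV_domain)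
  have "finite (UNIV \<rightarrow>\<^sub>E A :: ('d \<Rightarrow> 'a) set)" using assms by (intro finite_PiE) auto
  then show "finite {v :: 'a ^ 'd. \<forall>i. v $ i \<in> A}" using bij_betw_finite[OF bij] by simp
  show "card {v :: 'a ^ 'd. \<forall>i. v $ i \<in> A} = card A ^ CARD('d)"
    using bij_betw_same_card[OF bij] by (simp add: card_PiE)
qed

lemma finite_cube: "finite (cube n :: (int ^ 'd::finite) set)"
  unfolding cube_def by (intro finite_card_vec_box) auto

lemma finite_patterns: "finite (patterns (cube n) :: ((int ^ 'd::finite) \<Rightarrow> 's::finite) set)"
  unfolding patterns_def by (intro finite_PiE finite_cube) auto

text \<open>The reals are a vector space over the rationals, so sending 1 to 1 extends to a linear
  functional with rational values. Applied entrywise, it makes a real solution of a linear system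
  with integer data rational.\<close>

lemma ex_additive_rational:
  "\<exists>\<phi> :: real \<Rightarrow> real. Modules.additive \<phi> \<and> \<phi> 1 = 1 \<and> (\<forall>x. \<phi> x \<in> \<rat>)"
proof -
  interpret vector_space_pair "\<lambda>(q :: rat) (x :: real). of_rat q * x" "\<lambda>(q :: rat) x. q * x"
    by unfold_locales (auto simp: algebra_simps of_rat_add of_rat_mult)
  have "vs1.independent {1}" by simp
  then obtain g :: "real \<Rightarrow> rat" where
    g: "Vector_Spaces.linear (\<lambda>q x. of_rat q * x) (\<lambda>q x. q * x) g" "g 1 = 1"
    using linear_independent_extend[of "{1}" "\<lambda>_. 1"] by auto
  interpret g: Vector_Spaces.linear "\<lambda>(q :: rat) (x :: real). of_rat q * x" "\<lambda>(q :: rat) x. q * x" g by fact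
  show ?thesis
    by (rule exI[of _ "\<lambda>x. of_rat (g x)"]) (auto simp: Modules.additive_def g.add of_rat_add g)
qed

text \<open>A polytope of probability vectors cut out by equations with integer coefficients. Unlike
  measures, weights can be added and subtracted, so the arguments about extreme points take place
  here.\<close>

definition balanced_weights :: "'b set \<Rightarrow> ('b set \<times> 'b set) set \<Rightarrow> ('b \<Rightarrow> real) set" where
  "balanced_weights B R =
    {w. (\<forall>b. 0 \<le> w b) \<and> (\<forall>b. b \<notin> B \<longrightarrow> w b = 0) \<and> sum w B = 1 \<and>
        (\<forall>(A, A')\<in>R. sum w A = sum w A')}"

text \<open>A weight of minimal support is determined by its support and the linear constraints.\<close>

lemma ex_rigid_weight:
  assumes "finite B" and w: "w \<in> balanced_weights B R"
  obtains w' where "w' \<in> balanced_weights B R" "\<And>b. w' b \<noteq> 0 \<Longrightarrow> w b \<noteq> 0"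
    "\<And>(z :: _ \<Rightarrow> real) b. \<lbrakk>\<And>b. z b \<noteq> 0 \<Longrightarrow> w' b \<noteq> 0; sum z B = 0;
      \<And>A A'. (A, A') \<in> R \<Longrightarrow> sum z A = sum z A'\<rbrakk> \<Longrightarrow> z b = 0"
proof -
  define S where "S = {v \<in> balanced_weights B R. \<forall>b. v b \<noteq> 0 \<longrightarrow> w b \<noteq> 0}"
  have "w \<in> S" using w by (simp add: S_def)
  then obtain w' where w': "w' \<in> S" and
    least: "\<And>v. v \<in> S \<Longrightarrow> card {b. w' b \<noteq> 0} \<le> card {b. v b \<noteq> 0}"
    using ex_has_least_nat[of "\<lambda>v. v \<in> S" w "\<lambda>v. card {b. v b \<noteq> 0}"] by blast
  have nonneg: "0 \<le> w' b" and out: "b \<notin> B \<Longrightarrow> w' b = 0" for b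
    using w' by (auto simp: S_def balanced_weights_def)
  have fin: "finite {b. w' b \<noteq> 0}" using out by (intro finite_subset[OF _ \<open>finite B\<close>]) auto
  have rigid: "z b = 0"
    if supp: "\<And>b. z b \<noteq> 0 \<Longrightarrow> w' b \<noteq> 0" and "sum z B = 0"
      and R: "\<And>A A'. (A, A') \<in> R \<Longrightarrow> sum z A = sum z A'" for z :: "'a \<Rightarrow> real" and b
  proof (rule ccontr)
    assume "z b \<noteq> 0"
    have "b \<in> B" using supp[OF \<open>z b \<noteq> 0\<close>] out by blast
    \<comment> \<open>As \<open>z\<close> sums to 0 over \<open>B\<close> and is nonzero at
      \<open>b\<close>, it has a negative entry. Moving \<open>w'\<close> along \<open>z\<close>
      therefore leaves the nonnegative weights eventually.\<close>
    define N where "N = {c \<in> B. z c < 0}"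
    have "N \<noteq> {}"
    proof
      assume "N = {}"
      then have "\<And>c. c \<in> B \<Longrightarrow> 0 \<le> z c" by (auto simp: N_def not_less)
      then have "z b = 0" using \<open>sum z B = 0\<close> \<open>b \<in> B\<close> \<open>finite B\<close> by (simp add: sum_nonneg_eq_0_iff)
      with \<open>z b \<noteq> 0\<close> show False by blast
    qed
    have "finite N" using \<open>finite B\<close> by (simp add: N_def)
    \<comment> \<open>The largest step along \<open>z\<close> that keeps all weights nonnegative. At
      the minimising \<open>c\<close> the new weight \<open>v\<close> vanishes, so \<open>v\<close>
      has smaller support than \<open>w'\<close>, a contradiction.\<close>
    define t where "t = Min ((\<lambda>c. w' c / - z c) ` N)"
    obtain c where c: "c \<in> N" "t = w' c / - z c"
      using Min_in[of "(\<lambda>c. w' c / - z c) ` N"] \<open>finite N\<close> \<open>N \<noteq> {}\<close> unfolding t_def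
    by (auto simp del: Min_in)
    have "t \<le> w' c / - z c" if "c \<in> N" for c
      unfolding t_def using \<open>finite N\<close> that by (intro Min_le) auto
    then have neg: "0 \<le> w' c + t * z c" if "c \<in> N" for c
      using that by (fastforce simp: N_def field_simps)
    have "0 \<le> t" using c nonneg[of c] by (simp add: N_def divide_nonneg_neg)
    define v where "v a = w' a + t * z a" for a
    have "0 \<le> v a" for a
    proof (cases "a \<in> N")
      case False
      then have "0 \<le> z a" using out[of a] supp[of a] by (cases "z a = 0") (auto simp: N_def)
      then show ?thesis using \<open>0 \<le> t\<close> nonneg[of a] by (simp add: v_def)
    qed (simp add: neg v_def)
    moreover have "w' a \<noteq> 0" if "v a \<noteq> 0" for a
      using that supp[of a] by (auto simp: v_def)
    moreover have sum_v: "sum v A = sum w' A + t * sum z A" for A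
      by (simp add: v_def sum.distrib sum_distrib_left)
    then have "sum v B = 1" "\<forall>(A, A')\<in>R. sum v A = sum v A'"
      using w' R \<open>sum z B = 0\<close> by (auto simp: S_def balanced_weights_def)
    ultimately have "v \<in> S"
      using w' out unfolding S_def balanced_weights_def by blast
    have "v c = 0" "w' c \<noteq> 0" using c supp[of c] by (auto simp: v_def N_def)
    then have "{a. v a \<noteq> 0} \<subset> {a. w' a \<noteq> 0}"
      using \<open>\<And>a. v a \<noteq> 0 \<Longrightarrow> w' a \<noteq> 0\<close> by auto
    then have "card {a. v a \<noteq> 0} < card {a. w' a \<noteq> 0}" by (rule psubset_card_mono[OF fin])
    with least[OF \<open>v \<in> S\<close>] show False by simp
  qed
  show thesis using w' rigid by (intro that[of w']) (auto simp: S_def)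
qed

text \<open>For an additive \<open>\<phi>\<close> with \<open>\<phi> 1 = 1\<close>, the difference
  of \<open>\<phi> (w b)\<close> and \<open>w b\<close> solves the homogeneous system and vanishes
  wherever \<open>w\<close> does. Rigidity makes it 0, so \<open>w\<close> takes the rational values
  of \<open>\<phi>\<close>.\<close>

lemma rational_if_rigid:
  assumes w: "w \<in> balanced_weights B R"
    and rigid: "\<And>(z :: _ \<Rightarrow> real) b. \<lbrakk>\<And>b. z b \<noteq> 0 \<Longrightarrow> w b \<noteq> 0; sum z B = 0;
      \<And>A A'. (A, A') \<in> R \<Longrightarrow> sum z A = sum z A'\<rbrakk> \<Longrightarrow> z b = 0"
  shows "w b \<in> \<rat>"
proof -
  obtain \<phi> :: "real \<Rightarrow> real" where \<phi>: "Modules.additive \<phi>" "\<phi> 1 = 1" "\<And>x. \<phi> x \<in> \<rat>"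
    using ex_additive_rational by blast
  interpret Modules.additive \<phi> by fact
  have sum_\<phi>: "(\<Sum>a\<in>A. \<phi> (w a) - w a) = \<phi> (sum w A) - sum w A" for A
    by (simp add: sum sum_subtractf)
  have "\<phi> (w b) - w b = 0"
  proof (rule rigid[where z = "\<lambda>b. \<phi> (w b) - w b"])
    show "(\<Sum>a\<in>B. \<phi> (w a) - w a) = 0"
      unfolding sum_\<phi> using w \<phi> by (simp add: balanced_weights_def)
    show "(\<Sum>a\<in>A. \<phi> (w a) - w a) = (\<Sum>a\<in>A'. \<phi> (w a) - w a)" if "(A, A') \<in> R" for A A'
      unfolding sum_\<phi> using w that by (auto simp: balanced_weights_def)
    show "w b \<noteq> 0" if "\<phi> (w b) - w b \<noteq> 0" for b using that zero by auto
  qed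
  then show ?thesis using \<phi>(3)[of "w b"] by simp
qed

section \<open>From balanced weights to locally invariant measures\<close>

definition local_invariance :: "nat \<Rightarrow> (((int ^ 'd) \<Rightarrow> 's) set \<times> ((int ^ 'd) \<Rightarrow> 's) set) set" where
  "local_invariance n =
    {(cylinder n E a, cylinder n (translate E u) (shift_pattern E u a)) | E a u.
      E \<subseteq> cube n \<and> a \<in> patterns E \<and> translate E u \<subseteq> cube n}"

lemma cylinder_subset: "cylinder n E a \<subseteq> patterns (cube n)"
  by (auto simp: cylinder_def)

lemma measure_eq_sum_singletons:
  fixes \<mu> :: "((int ^ 'd::finite) \<Rightarrow> 's::finite) measure"
  assumes "\<mu> \<in> locally_invariant_measures n" and "A \<subseteq> patterns (cube n)"
  shows "measure \<mu> A = (\<Sum>b\<in>A. measure \<mu> {b})"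
proof -
  have \<mu>: "prob_space \<mu>" "sets \<mu> = Pow (patterns (cube n))"
    using assms by (auto simp: locally_invariant_measures_def prob_measures_def)
  interpret prob_space \<mu> by fact
  show ?thesis
    using assms finite_patterns by (intro finite_measure_eq_sum_singleton)
      (auto simp: \<mu> dest: finite_subset)
qed

lemma point_measure_locally_invariant:
  fixes w :: "((int ^ 'd::finite) \<Rightarrow> 's::finite) \<Rightarrow> real"
  assumes w: "w \<in> balanced_weights (patterns (cube n)) (local_invariance n)"
  shows "point_measure (patterns (cube n)) w \<in> locally_invariant_measures n"
    and "measure (point_measure (patterns (cube n)) w) {b} = w b"
proof -
  let ?\<nu> = "point_measure (patterns (cube n)) w"
  have nonneg: "0 \<le> w b" for b using w by (simp add: balanced_weights_def)
  have m: "measure ?\<nu> A = (if A \<subseteq> patterns (cube n) then sum w A else 0)" for A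
    using nonneg by (intro measure_point_measure_finite_if[OF finite_patterns])
  show "measure ?\<nu> {b} = w b" using w by (auto simp: m balanced_weights_def)
  have "emeasure ?\<nu> (space ?\<nu>) = 1"
    using w nonneg by (subst emeasure_point_measure_finite[OF finite_patterns])
      (auto simp: space_point_measure balanced_weights_def)
  then have "prob_space ?\<nu>" by (rule prob_spaceI)
  moreover have "measure ?\<nu> (cylinder n E a) =
      measure ?\<nu> (cylinder n (translate E u) (shift_pattern E u a))"
    if "E \<subseteq> cube n" "a \<in> patterns E" "translate E u \<subseteq> cube n" for E a u
  proof -
    have "(cylinder n E a, cylinder n (translate E u) (shift_pattern E u a)) \<in> local_invariance n"
      using that unfolding local_invariance_def by blast
    with w have "sum w (cylinder n E a) = sum w (cylinder n (translate E u) (shift_pattern E u a))"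
      unfolding balanced_weights_def by blast
    then show ?thesis by (simp add: m cylinder_subset)
  qed
  ultimately show "?\<nu> \<in> locally_invariant_measures n"
    by (simp add: locally_invariant_measures_def prob_measures_def sets_point_measure)
qed

text \<open>A rigid weight below \<open>w\<close> gives the measure. If it is a proper mixture of
  two locally invariant measures, their difference on points solves the homogeneous system inside
  the support of the rigid weight, hence is 0.\<close>

lemma ex_extreme_rational_measure:
  fixes w :: "((int ^ 'd::finite) \<Rightarrow> 's::finite) \<Rightarrow> real"
  assumes "w \<in> balanced_weights (patterns (cube n)) (local_invariance n)"
  obtains \<nu> where "extreme_measure \<nu> (locally_invariant_measures n)"
    "\<And>b. measure \<nu> {b} \<noteq> 0 \<Longrightarrow> w b \<noteq> 0" "\<And>b. measure \<nu> {b} \<in> \<rat>"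
proof -
  let ?B = "patterns (cube n) :: ((int ^ 'd) \<Rightarrow> 's) set"
  obtain w' where w': "w' \<in> balanced_weights ?B (local_invariance n)"
    and supp: "\<And>b. w' b \<noteq> 0 \<Longrightarrow> w b \<noteq> 0"
    and rigid: "\<And>(z :: _ \<Rightarrow> real) b. \<lbrakk>\<And>b. z b \<noteq> 0 \<Longrightarrow> w' b \<noteq> 0; sum z ?B = 0;
      \<And>A A'. (A, A') \<in> local_invariance n \<Longrightarrow> sum z A = sum z A'\<rbrakk> \<Longrightarrow> z b = 0"
    by (rule ex_rigid_weight[OF finite_patterns assms]) blast
  let ?\<nu> = "point_measure ?B w'"
  note \<nu> = point_measure_locally_invariant[OF w']
  have "extreme_measure ?\<nu> (locally_invariant_measures n)"
    unfolding extreme_measure_def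
  proof (intro conjI \<nu> ballI allI impI)
    fix \<mu>\<^sub>1 \<mu>\<^sub>2 :: "((int ^ 'd) \<Rightarrow> 's) measure" and t :: real
    assume \<mu>: "\<mu>\<^sub>1 \<in> locally_invariant_measures n" "\<mu>\<^sub>2 \<in> locally_invariant_measures n"
      and t: "0 < t" "t < 1"
      and comb: "\<forall>A\<in>sets ?\<nu>. measure ?\<nu> A = (1 - t) * measure \<mu>\<^sub>1 A + t * measure \<mu>\<^sub>2 A"
    have sets: "sets \<mu>\<^sub>1 = Pow ?B" "sets \<mu>\<^sub>2 = Pow ?B" and prob: "prob_space \<mu>\<^sub>1" "prob_space \<mu>\<^sub>2"
      using \<mu> by (auto simp: locally_invariant_measures_def prob_measures_def)
    have space: "space \<mu>\<^sub>1 = ?B" "space \<mu>\<^sub>2 = ?B"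
      using sets by (metis sets_eq_imp_space_eq sets_count_space space_count_space)+
    note sums = measure_eq_sum_singletons[OF \<mu>(1)] measure_eq_sum_singletons[OF \<mu>(2)]
    let ?z = "\<lambda>b. measure \<mu>\<^sub>1 {b} - measure \<mu>\<^sub>2 {b}"
    have "?z b = 0" for b
    proof (rule rigid[where z = ?z])
      fix b assume "?z b \<noteq> 0"
      then have "b \<in> ?B" using measure_notin_sets[of "{b}"] sets by (cases "b \<in> ?B") auto
      then have "w' b = (1 - t) * measure \<mu>\<^sub>1 {b} + t * measure \<mu>\<^sub>2 {b}"
        using comb \<nu>(2)[of b] by (auto simp: sets_point_measure)
      \<comment> \<open>Masses are nonnegative and both coefficients positive, so nothing cancels: a
        point charged by either component is charged by the mixture.\<close>
      moreover have "0 < (1 - t) * measure \<mu>\<^sub>1 {b} + t * measure \<mu>\<^sub>2 {b}"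
      proof (cases "measure \<mu>\<^sub>1 {b} = 0")
        case True
        then have "0 < measure \<mu>\<^sub>2 {b}" using \<open>?z b \<noteq> 0\<close> by (simp add: zero_less_measure_iff)
        then show ?thesis using t True by simp
      next
        case False
        then have "0 < measure \<mu>\<^sub>1 {b}" by (simp add: zero_less_measure_iff)
        then show ?thesis using t by (intro add_pos_nonneg) auto
      qed
      ultimately show "w' b \<noteq> 0" by simp
    next
      show "sum ?z ?B = 0"
        using sums[of ?B] prob_space.prob_space[OF prob(1)] prob_space.prob_space[OF prob(2)]
        by (simp add: sum_subtractf space)
    next
      fix A A' :: "((int ^ 'd) \<Rightarrow> 's) set"
      assume A: "(A, A') \<in> local_invariance n"
      then have "A \<subseteq> ?B" "A' \<subseteq> ?B" by (auto simp: local_invariance_def cylinder_def)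
      moreover have "measure \<mu>\<^sub>1 A = measure \<mu>\<^sub>1 A'" "measure \<mu>\<^sub>2 A = measure \<mu>\<^sub>2 A'"
        using A \<mu> by (auto simp: local_invariance_def locally_invariant_measures_def)
      ultimately show "sum ?z A = sum ?z A'"
        unfolding sum_subtractf by (simp only: sums[symmetric])
    qed
    then have eq: "measure \<mu>\<^sub>1 A = measure \<mu>\<^sub>2 A" if "A \<subseteq> ?B" for A
      using sums(1)[OF that] sums(2)[OF that] by simp
    show "\<mu>\<^sub>1 = \<mu>\<^sub>2"
    proof (rule measure_eqI)
      fix A assume "A \<in> sets \<mu>\<^sub>1"
      interpret m1: prob_space \<mu>\<^sub>1 by fact
      interpret m2: prob_space \<mu>\<^sub>2 by fact
      show "emeasure \<mu>\<^sub>1 A = emeasure \<mu>\<^sub>2 A"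
        using eq \<open>A \<in> sets \<mu>\<^sub>1\<close> sets by (simp add: m1.emeasure_eq_measure m2.emeasure_eq_measure)
    qed (simp add: sets)
  qed
  moreover have "w' b \<in> \<rat>" for b
    using w' by (rule rational_if_rigid) (erule rigid, assumption+)
  ultimately show thesis using supp \<nu>(2) by (intro that[of ?\<nu>]) auto
qed

section \<open>Empirical measures\<close>

lemma restrict_mem_cylinder_iff:
  assumes "E \<subseteq> cube n" "a \<in> patterns E"
  shows "restrict y (cube n) \<in> cylinder n E a \<longleftrightarrow> (\<forall>v\<in>E. y v = a v)"
proof -
  have "restrict (restrict y (cube n)) E = restrict y E"
    using assms by (simp add: Int_absorb1)
  moreover have "restrict y E = a \<longleftrightarrow> (\<forall>v\<in>E. y v = a v)"
    using assms by (auto simp: patterns_def fun_eq_iff restrict_def PiE_def extensional_def)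
  ultimately show ?thesis by (simp add: cylinder_def patterns_def)
qed

definition lattice_box :: "nat \<Rightarrow> (int ^ 'd) set" where
  "lattice_box K = {v. \<forall>i. v $ i \<in> {0..<int K}}"

lemma finite_box: "finite (lattice_box K :: (int ^ 'd::finite) set)"
  and card_box: "card (lattice_box K :: (int ^ 'd) set) = K ^ CARD('d)"
  unfolding lattice_box_def using finite_card_vec_box[of "{0..<int K}"] by auto

text \<open>The counts concern \<open>T\<close> inside the box and inside its translate by
  \<open>- c\<close>. Both sets have the same size and contain the inner box \<open>I\<close>, so
  both counts lie between \<open>card (I \<inter> T)\<close> and that number plus the size of the
  complement of \<open>I\<close>.\<close>

lemma card_box_translate_diff:
  fixes c :: "int ^ 'd::finite"
  assumes c: "\<And>i. \<bar>c $ i\<bar> \<le> int W" and K: "2 * W \<le> K"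
  shows "\<bar>real (card {u \<in> lattice_box K. u \<in> T}) - real (card {u \<in> lattice_box K. u - c \<in> T})\<bar> \<le>
    real K ^ CARD('d) - real (K - 2 * W) ^ CARD('d)"
proof -
  define I :: "(int ^ 'd) set" where "I = {v. \<forall>i. v $ i \<in> {int W..<int K - int W}}"
  have I: "finite I" "card I = (K - 2 * W) ^ CARD('d)"
    unfolding I_def using finite_card_vec_box[of "{int W..<int K - int W}", where 'd = 'd] K
    by (auto simp: nat_diff_distrib nat_mult_distrib)
  have sub: "I \<subseteq> D" "finite D" "card D = K ^ CARD('d)"
    if "D = lattice_box K \<or> D = (\<lambda>u. u - c) ` lattice_box K" for D :: "(int ^ 'd) set"
  proof -
    show "finite D" "card D = K ^ CARD('d)"
      using that finite_box card_box[of K, where 'd = 'd] by (auto simp: card_image inj_on_def)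
    show "I \<subseteq> D"
    proof
      fix v assume v: "v \<in> I"
      have "0 \<le> v $ i \<and> v $ i < int K \<and> 0 \<le> v $ i + c $ i \<and> v $ i + c $ i < int K" for i
      proof -
        have "int W \<le> v $ i" "v $ i < int K - int W" using v by (auto simp: I_def)
        with c[of i] show ?thesis by linarith
      qed
      then have "v \<in> lattice_box K" "v + c \<in> lattice_box K" by (auto simp: lattice_box_def)
      then show "v \<in> D" using that by (auto intro: image_eqI[of _ _ "v + c"])
    qed
  qed
  have approx: "real (card (D \<inter> T)) \<in>
      {real (card (I \<inter> T))..real (card (I \<inter> T)) + (real K ^ CARD('d) - real (K - 2 * W) ^ CARD('d))}"
    if D: "D = lattice_box K \<or> D = (\<lambda>u. u - c) ` lattice_box K" for D :: "(int ^ 'd) set"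
  proof -
    note sub = sub[OF D]
    have "card (I \<inter> T) \<le> card (D \<inter> T)" using sub I(1) by (intro card_mono) auto
    moreover have "card (D \<inter> T) \<le> card ((I \<inter> T) \<union> (D - I))" using sub I(1) by (intro card_mono) auto
    then have "card (D \<inter> T) \<le> card (I \<inter> T) + card (D - I)"
      using card_Un_le[of "I \<inter> T" "D - I"] by linarith
    moreover have "card (D - I) = card D - card I" "card I \<le> card D"
      using card_Diff_subset[OF I(1) sub(1)] card_mono[OF sub(2,1)] by auto
    ultimately have "card (D \<inter> T) + card I \<le> card (I \<inter> T) + card D" by linarith
    then have "real (card (D \<inter> T)) + real (card I) \<le> real (card (I \<inter> T)) + real (card D)"
      by (simp only: of_nat_le_iff flip: of_nat_add)
    with \<open>card (I \<inter> T) \<le> card (D \<inter> T)\<close> show ?thesis using sub I by simp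
  qed
  have "{u \<in> lattice_box K. u \<in> T} = lattice_box K \<inter> T" by blast
  moreover have "(\<lambda>u. u - c) ` {u \<in> lattice_box K. u - c \<in> T} = (\<lambda>u. u - c) ` lattice_box K \<inter> T" by auto
  then have "card {u \<in> lattice_box K. u - c \<in> T} = card ((\<lambda>u. u - c) ` lattice_box K \<inter> T)"
    by (metis (no_types, lifting) card_image diff_add_cancel inj_onI)
  ultimately show ?thesis
    using approx[of "lattice_box K"] approx[of "(\<lambda>u. u - c) ` lattice_box K"] by auto
qed

text \<open>The subsequence is refined once for each element of \<open>B\<close>, by compactness of
  the unit interval.\<close>

lemma common_convergent_subseq:
  fixes f :: "nat \<Rightarrow> 'b \<Rightarrow> real"
  assumes "finite B" and f: "\<And>k b. f k b \<in> {0..1}"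
  shows "\<exists>l r. strict_mono (r :: nat \<Rightarrow> nat) \<and> (\<forall>b\<in>B. (\<lambda>k. f (r k) b) \<longlonglongrightarrow> l b)"
  using \<open>finite B\<close>
proof induction
  case empty
  show ?case using strict_mono_id by auto
next
  case (insert c B)
  then obtain l r where r: "strict_mono (r :: nat \<Rightarrow> nat)"
    and l: "\<And>b. b \<in> B \<Longrightarrow> (\<lambda>k. f (r k) b) \<longlonglongrightarrow> l b" by blast
  have "seq_compact {0..1::real}" by (simp add: compact_imp_seq_compact)
  then obtain y s where s: "strict_mono (s :: nat \<Rightarrow> nat)" "((\<lambda>k. f (r k) c) \<circ> s) \<longlonglongrightarrow> y"
    using f by (elim seq_compactE[where f = "\<lambda>k. f (r k) c"]) auto
  have "(\<lambda>k. f ((r \<circ> s) k) b) \<longlonglongrightarrow> (l(c := y)) b" if "b \<in> insert c B" for b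
    using that s(2) LIMSEQ_subseq_LIMSEQ[OF l s(1)] insert.hyps(2) by (auto simp: o_def)
  then show ?case using strict_mono_o[OF r s(1)] by blast
qed

text \<open>The weights are limits of the empirical frequencies of the patterns of \<open>x\<close> in large boxes.\<close>

lemma ex_empirical_weight:
  fixes x :: "(int ^ 'd::finite) \<Rightarrow> 's::finite"
  obtains w where "w \<in> balanced_weights (patterns (cube n)) (local_invariance n)"
    "\<And>b. w b \<noteq> 0 \<Longrightarrow> \<exists>u. b = restrict (shift u x) (cube n)"
proof -
  let ?B = "patterns (cube n) :: ((int ^ 'd) \<Rightarrow> 's) set"
  let ?pat = "\<lambda>u. restrict (shift u x) (cube n)"
  define f where "f K b = real (card {u \<in> lattice_box (Suc K). ?pat u = b}) / real (Suc K) ^ CARD('d)"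
    for K :: nat and b
  have sum_f: "sum (f K) A = real (card {u \<in> lattice_box (Suc K). ?pat u \<in> A}) / real (Suc K) ^ CARD('d)"
    if "A \<subseteq> ?B" for K A
  proof -
    have "finite A" using that finite_patterns by (rule finite_subset)
    have "{u \<in> lattice_box (Suc K). ?pat u \<in> A} = (\<Union>b\<in>A. {u \<in> lattice_box (Suc K). ?pat u = b})" by auto
    then have "card {u \<in> lattice_box (Suc K). ?pat u \<in> A} = (\<Sum>b\<in>A. card {u \<in> lattice_box (Suc K). ?pat u = b})"
      unfolding \<open>{u \<in> lattice_box (Suc K). ?pat u \<in> A} = _\<close>
      using \<open>finite A\<close> by (intro card_UN_disjoint) (auto intro: finite_subset[OF _ finite_box])
    then show ?thesis by (simp add: f_def sum_divide_distrib)
  qed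
  have f01: "f K b \<in> {0..1}" for K b
  proof -
    have "card {u \<in> lattice_box (Suc K). ?pat u = b} \<le> card (lattice_box (Suc K) :: (int ^ 'd) set)"
      by (intro card_mono finite_box) auto
    then have "real (card {u \<in> lattice_box (Suc K). ?pat u = b}) \<le> real (Suc K) ^ CARD('d)"
      unfolding card_box by (simp only: of_nat_le_iff flip: of_nat_power)
    then show ?thesis by (simp add: f_def)
  qed
  obtain l r where r: "strict_mono (r :: nat \<Rightarrow> nat)"
    and l: "\<And>b. b \<in> ?B \<Longrightarrow> (\<lambda>k. f (r k) b) \<longlonglongrightarrow> l b"
    using common_convergent_subseq[of ?B f, OF finite_patterns f01] by blast
  define w where "w b = (if b \<in> ?B then l b else 0)" for b
  have w_lim: "(\<lambda>k. sum (f (r k)) A) \<longlonglongrightarrow> sum w A" if "A \<subseteq> ?B" for A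
  proof (rule tendsto_sum)
    fix b assume "b \<in> A"
    with l[of b] that show "(\<lambda>k. f (r k) b) \<longlonglongrightarrow> w b" by (auto simp: w_def)
  qed
  have "0 \<le> w b" for b
  proof (cases "b \<in> ?B")
    case True
    then show ?thesis
      using LIMSEQ_le_const[OF l[OF True], of 0] f01 by (auto simp: w_def)
  qed (simp add: w_def)
  moreover have "sum w ?B = 1"
  proof -
    have "?pat u \<in> ?B" for u by (simp add: patterns_def)
    then have "sum (f K) ?B = 1" for K by (simp add: sum_f card_box del: of_nat_Suc)
    then show ?thesis using w_lim[of ?B] LIMSEQ_unique[OF _ tendsto_const] by fastforce
  qed
  moreover have "sum w A = sum w A'" if AA': "(A, A') \<in> local_invariance n" for A A'
  proof -
    obtain E a c where A: "A = cylinder n E a" "A' = cylinder n (translate E c) (shift_pattern E c a)"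
      and E: "E \<subseteq> cube n" "a \<in> patterns E" "translate E c \<subseteq> cube n"
      using AA' by (auto simp: local_invariance_def)
    \<comment> \<open>\<open>T\<close> is the set of positions where \<open>a\<close> occurs in
      \<open>x\<close>. The shifted cylinder is seen at \<open>u\<close> exactly when
      \<open>a\<close> occurs at \<open>u - c\<close>, so the two frequencies count \<open>T\<close>
      in a box and in a translate of it.\<close>
    define T where "T = {u. \<forall>v\<in>E. x (u + v) = a v}"
    have mem: "?pat u \<in> A \<longleftrightarrow> u \<in> T" for u
      unfolding A restrict_mem_cylinder_iff[OF E(1,2)] by (simp add: T_def shift_def)
    have "shift_pattern E c a \<in> patterns (translate E c)"
      by (simp add: shift_pattern_def patterns_def)
    from restrict_mem_cylinder_iff[OF E(3) this]
    have mem': "?pat u \<in> A' \<longleftrightarrow> u - c \<in> T" for u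
      unfolding A
      by (auto simp: T_def shift_def shift_pattern_def translate_def algebra_simps)
    have sub: "A \<subseteq> ?B" "A' \<subseteq> ?B" unfolding A by (rule cylinder_subset)+
    have f_sums:
      "sum (f K) A = real (card {u \<in> lattice_box (Suc K). u \<in> T}) / real (Suc K) ^ CARD('d)"
      "sum (f K) A' = real (card {u \<in> lattice_box (Suc K). u - c \<in> T}) / real (Suc K) ^ CARD('d)" for K
      unfolding sum_f[OF sub(1)] sum_f[OF sub(2)] mem mem' by (rule refl)+
    define W where "W = nat (\<Sum>i\<in>UNIV. \<bar>c $ i\<bar>)"
    have W: "\<bar>c $ i\<bar> \<le> int W" for i
      unfolding W_def using member_le_sum[of i UNIV "\<lambda>i. \<bar>c $ i\<bar>"] by (simp add: sum_nonneg)
    \<comment> \<open>The frequencies differ only by a boundary effect: an inner box with sides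
      shorter by \<open>2 * W\<close> fills a proportion of the box tending to 1.\<close>
    have bound: "norm (sum (f K) A - sum (f K) A') \<le>
        1 - ((real (Suc K) - 2 * real W) / real (Suc K)) ^ CARD('d)" if "2 * W \<le> K" for K
    proof -
      have "\<bar>real (card {u \<in> lattice_box (Suc K). u \<in> T}) - real (card {u \<in> lattice_box (Suc K). u - c \<in> T})\<bar> \<le>
          real (Suc K) ^ CARD('d) - (real (Suc K) - 2 * real W) ^ CARD('d)"
        using card_box_translate_diff[OF W, of "Suc K" T] that by (simp add: of_nat_diff)
      then have "\<bar>real (card {u \<in> lattice_box (Suc K). u \<in> T}) - real (card {u \<in> lattice_box (Suc K). u - c \<in> T})\<bar>
          / real (Suc K) ^ CARD('d) \<le>
          (real (Suc K) ^ CARD('d) - (real (Suc K) - 2 * real W) ^ CARD('d)) / real (Suc K) ^ CARD('d)"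
        by (intro divide_right_mono) auto
      then show ?thesis
        by (simp add: f_sums diff_divide_distrib[symmetric] power_divide abs_divide del: of_nat_Suc)
          (simp add: diff_divide_distrib del: of_nat_Suc)
    qed
    have "(\<lambda>K. 1 - ((real (Suc K) - 2 * real W) / real (Suc K)) ^ CARD('d)) \<longlonglongrightarrow> 1 - 1 ^ CARD('d)"
      by (intro tendsto_intros) real_asymp
    then have lim: "(\<lambda>K. 1 - ((real (Suc K) - 2 * real W) / real (Suc K)) ^ CARD('d)) \<longlonglongrightarrow> 0" by simp
    have "\<forall>\<^sub>F K in sequentially. norm (sum (f K) A - sum (f K) A') \<le>
        1 - ((real (Suc K) - 2 * real W) / real (Suc K)) ^ CARD('d)"
      using bound by (rule eventually_sequentiallyI)
    then have "(\<lambda>K. sum (f K) A - sum (f K) A') \<longlonglongrightarrow> 0" using lim by (rule Lim_null_comparison)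
    then have "(\<lambda>k. sum (f (r k)) A - sum (f (r k)) A') \<longlonglongrightarrow> 0"
      using LIMSEQ_subseq_LIMSEQ[OF _ r] by (fastforce simp: o_def)
    moreover have "(\<lambda>k. sum (f (r k)) A - sum (f (r k)) A') \<longlonglongrightarrow> sum w A - sum w A'"
      by (intro tendsto_diff w_lim sub)
    ultimately show ?thesis using LIMSEQ_unique by fastforce
  qed
  ultimately have "w \<in> balanced_weights ?B (local_invariance n)"
    by (auto simp: balanced_weights_def w_def)
  moreover have "\<exists>u. b = ?pat u" if "w b \<noteq> 0" for b
  proof (rule ccontr)
    assume none: "\<nexists>u. b = ?pat u"
    then have "{u \<in> lattice_box (Suc K). ?pat u = b} = {}" for K by blast
    then have "f K b = 0" for K unfolding f_def by (simp only: card.empty of_nat_0 div_0)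
    moreover have "b \<in> ?B" using that by (auto simp: w_def split: if_splits)
    ultimately show False using l[of b] that LIMSEQ_unique[OF _ tendsto_const] by (auto simp: w_def)
  qed
  ultimately show thesis by (rule that)
qed

section \<open>Marginals of invariant measures\<close>

lemma sets_config_borel: "sets config_borel = sigma_sets UNIV {U. openin config_topology U}"
  unfolding config_borel_def by (simp add: sets_measure_of_conv)

lemma space_config_borel: "space config_borel = UNIV"
  unfolding config_borel_def by (simp add: space_measure_of_conv)

text \<open>The event depends on finitely many coordinates, so with each configuration it contains a
  basic open set of the product topology.\<close>

lemma window_event_measurable:
  fixes P :: "((int ^ 'd::finite) \<Rightarrow> 's) \<Rightarrow> bool"
  shows "{x. P (restrict x (cube n))} \<in> sets config_borel"
proof -
  have "openin config_topology {x. P (restrict x (cube n))}"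
    unfolding config_topology_def openin_product_topology_alt
  proof safe
    fix x :: "(int ^ 'd) \<Rightarrow> 's" assume x: "P (restrict x (cube n))"
    define U where "U v = (if v \<in> cube n then {x v} else UNIV)" for v
    have "{v. U v \<noteq> UNIV} \<subseteq> cube n" by (auto simp: U_def)
    then have "finite {v. U v \<noteq> UNIV}" using finite_cube finite_subset by blast
    moreover have "P (restrict y (cube n))" if "y \<in> Pi\<^sub>E UNIV U" for y
    proof -
      have "y v = x v" if "v \<in> cube n" for v
        using PiE_mem[OF \<open>y \<in> Pi\<^sub>E UNIV U\<close>, of v] that by (simp add: U_def)
      then have "restrict y (cube n) = restrict x (cube n)" by (auto simp: restrict_def)
      with x show ?thesis by simp
    qed
    ultimately show "\<exists>U. finite {i \<in> UNIV. U i \<noteq> topspace (discrete_topology UNIV)} \<and>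
        (\<forall>i\<in>UNIV. openin (discrete_topology UNIV) (U i)) \<and> x \<in> Pi\<^sub>E UNIV U \<and>
        Pi\<^sub>E UNIV U \<subseteq> {x. P (restrict x (cube n))}"
      by (intro exI[of _ U]) (auto simp: U_def)
  qed
  then show ?thesis unfolding sets_config_borel by (intro sigma_sets.Basic) simp
qed

lemma shift_measurable: "shift u \<in> measurable config_borel config_borel"
proof -
  have "continuous_map config_topology config_topology (shift u)"
    unfolding config_topology_def continuous_map_componentwise_UNIV shift_def
    by (auto intro: continuous_map_product_projection)
  then have "openin config_topology (shift u -` U)" if "openin config_topology U" for U
    using openin_continuous_map_preimage[OF _ that]
    by (fastforce simp: config_topology_def vimage_def)
  then have "shift u -` U \<inter> space config_borel \<in> sets config_borel"
    if "openin config_topology U" for U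
    using that by (auto simp: space_config_borel sets_config_borel intro!: sigma_sets.Basic)
  then have "shift u \<in> measurable config_borel (sigma UNIV {U. openin config_topology U})"
    by (intro measurable_measure_of) auto
  then show ?thesis by (simp only: config_borel_def)
qed

text \<open>Invariance moves the window at \<open>u\<close> back to the origin, where
  \<open>marginal n\<close> decides the event. Thus the marginal fixes the probabilities of local
  events at every position.\<close>

lemma marginal_window_event:
  fixes \<mu> :: "((int ^ 'd::finite) \<Rightarrow> 's::finite) measure"
  assumes "\<mu> \<in> invariant_measures"
  shows "{y. P (restrict (shift u y) (cube n))} \<in> sets \<mu>"
    and "measure \<mu> {y. P (restrict (shift u y) (cube n))} =
      measure (marginal n \<mu>) {b \<in> patterns (cube n). P b}"
proof -
  have \<mu>: "sets \<mu> = sets config_borel" "distr \<mu> config_borel (shift u) = \<mu>"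
    using assms by (auto simp: invariant_measures_def)
  have space: "space \<mu> = UNIV" using sets_eq_imp_space_eq[OF \<mu>(1)] space_config_borel by simp
  have shift: "shift u \<in> measurable \<mu> config_borel"
    using shift_measurable measurable_cong_sets[OF \<mu>(1) refl] by blast
  have event: "{y. P (restrict y (cube n))} \<in> sets config_borel" for P :: "((int ^ 'd) \<Rightarrow> 's) \<Rightarrow> bool"
    by (rule window_event_measurable)
  have "restrict y (cube n) \<in> patterns (cube n)" for y :: "(int ^ 'd) \<Rightarrow> 's"
    by (simp add: patterns_def)
  then have restrict: "(\<lambda>x. restrict x (cube n)) \<in> measurable \<mu> (count_space (patterns (cube n)))"
    using event unfolding measurable_count_space_eq2[OF finite_patterns]
    by (auto simp: space \<mu>(1) vimage_def)
  show "{y. P (restrict (shift u y) (cube n))} \<in> sets \<mu>"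
    using measurable_sets[OF shift event] by (simp add: space vimage_def)
  have "measure \<mu> {y. P (restrict (shift u y) (cube n))} =
      measure (distr \<mu> config_borel (shift u)) {y. P (restrict y (cube n))}"
    using measure_distr[OF shift event] by (simp add: space vimage_def)
  also have "\<dots> = measure \<mu> {y. P (restrict y (cube n))}" by (simp add: \<mu>)
  also have "\<dots> = measure (marginal n \<mu>) {b \<in> patterns (cube n). P b}"
    unfolding marginal_def
    by (subst measure_distr[OF restrict]) (auto simp: space vimage_def patterns_def)
  finally show "measure \<mu> {y. P (restrict (shift u y) (cube n))} =
      measure (marginal n \<mu>) {b \<in> patterns (cube n). P b}" .
qed

section \<open>Planar slices of configurations\<close>

text \<open>The slice through the origin spanned by the axes \<open>p\<close> and \<open>q\<close>,
  with columns \<open>i\<close> along \<open>p\<close> and rows \<open>j\<close> along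
  \<open>q\<close>. Coding one letter as 1 and all others as 0 reduces any alphabet and dimension to
  binary arrays.\<close>

definition plane :: "'d \<Rightarrow> 'd \<Rightarrow> 's \<Rightarrow> ((int ^ 'd) \<Rightarrow> 's) \<Rightarrow> int \<Rightarrow> int \<Rightarrow> int" where
  "plane p q s x j i = of_bool (x (axis p i + axis q j) = s)"

lemma plane_01: "plane p q s x j i \<in> {0..1}"
  by (simp add: plane_def)

lemma plane_shift:
  "plane p q s (shift (axis p i' + axis q j') x) j i = plane p q s x (j' + j) (i' + i)"
proof -
  have "axis p i' + axis q j' + (axis p i + axis q j) = axis p (i' + i) + axis q (j' + j)"
    by (simp add: vec_eq_iff axis_def)
  then show ?thesis by (simp add: plane_def shift_def)
qed

lemma plane_restrict:
  fixes x :: "(int ^ 'd::finite) \<Rightarrow> 's"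
  assumes "p \<noteq> q" "i \<in> {0..int n}" "j \<in> {0..int n}"
  shows "plane p q s (restrict x (cube n)) j i = plane p q s x j i"
proof -
  have "axis p i + axis q j \<in> cube n" using assms by (auto simp: cube_def axis_def)
  then show ?thesis by (simp add: plane_def)
qed

text \<open>At the origin the rule reads columns 0 to 12 of rows 0 and 1, and these cells lie in
  \<open>cube n\<close> once \<open>n\<close> is at least 12.\<close>

lemma admissible_plane_restrict:
  assumes "p \<noteq> q" "12 \<le> n"
  shows "admissible (plane p q s (restrict (shift (axis p i + axis q j) x) (cube n))) 0 0 \<longleftrightarrow>
      admissible (plane p q s x) j i"
    and "growing (plane p q s (restrict (shift (axis p i + axis q j) x) (cube n))) 0 0 \<longleftrightarrow>
      growing (plane p q s x) j i"
  using assms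
  by (auto intro!: admissible_cong growing_cong simp: plane_restrict plane_shift)

text \<open>Almost every configuration is admissible at all of the countably many positions, so
  \<open>card_growing_bound\<close> holds almost surely. By invariance every row grows with the same
  probability \<open>\<rho>\<close>. Integrating gives a multiple of \<open>K\<close> bounded by
  \<open>ln 12\<close> for all \<open>K\<close>, so its coefficient is 0.\<close>

lemma growing_frequency:
  fixes \<mu> :: "((int ^ 'd::finite) \<Rightarrow> 's::finite) measure"
  assumes \<mu>: "\<mu> \<in> invariant_measures" and pq: "p \<noteq> q" and n: "12 \<le> n"
    and adm: "measure (marginal n \<mu>) {b \<in> patterns (cube n). \<not> admissible (plane p q s b) 0 0} = 0"
  shows "measure (marginal n \<mu>) {b \<in> patterns (cube n). growing (plane p q s b) 0 0} *
    (ln 2 + ln 3) = ln 3"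
proof -
  interpret prob_space \<mu> using \<mu> by (simp add: invariant_measures_def)
  have "space \<mu> = UNIV"
    using \<mu> sets_eq_imp_space_eq[of \<mu> config_borel] by (simp add: invariant_measures_def space_config_borel)
  define \<rho> where "\<rho> = measure (marginal n \<mu>) {b \<in> patterns (cube n). growing (plane p q s b) 0 0}"
  define G where "G j = {y. growing (plane p q s y) j 0}" for j
  have G: "G j \<in> sets \<mu>" "measure \<mu> (G j) = \<rho>" for j
    using marginal_window_event[OF \<mu>, of "\<lambda>b. growing (plane p q s b) 0 0" "axis p 0 + axis q j" n]
    unfolding admissible_plane_restrict[OF pq n] G_def \<rho>_def by auto
  have "AE y in \<mu>. admissible (plane p q s y) j i" for j i
  proof -
    let ?N = "{y. \<not> admissible (plane p q s y) j i}"
    have "?N \<in> sets \<mu>" "measure \<mu> ?N = 0"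
      using adm marginal_window_event[OF \<mu>, of "\<lambda>b. \<not> admissible (plane p q s b) 0 0" "axis p i + axis q j" n]
      unfolding admissible_plane_restrict[OF pq n] by auto
    then show ?thesis
      by (intro AE_I[of _ _ ?N]) (auto simp: emeasure_eq_measure)
  qed
  then have adm: "AE y in \<mu>. \<forall>j i. admissible (plane p q s y) j i"
    by (simp add: AE_all_countable)
  have "\<bar>\<rho> * (ln 2 + ln 3) - ln 3\<bar> * real K \<le> 0 * real K + ln 12" for K
  proof -
    let ?f = "\<lambda>y. (\<Sum>j<K. indicator (G (int j)) y) * (ln 2 + ln 3) - real K * ln 3 :: real"
    have "AE y in \<mu>. - ln 12 \<le> ?f y \<and> ?f y \<le> ln 12"
      using adm
    proof eventually_elim
      case (elim y)
      have "\<bar>?f y\<bar> \<le> ln 12"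
        using card_growing_bound[of "plane p q s y" K, OF plane_01] elim
        by (simp add: G_def indicator_def)
      then show ?case by linarith
    qed
    then have AE: "AE y in \<mu>. - ln 12 \<le> ?f y" "AE y in \<mu>. ?f y \<le> ln 12" by auto
    have int: "integrable \<mu> ?f" using G by (auto simp: emeasure_eq_measure)
    have "integral\<^sup>L \<mu> ?f = real K * \<rho> * (ln 2 + ln 3) - real K * ln 3"
      using G by (simp add: emeasure_eq_measure prob_space)
    with integral_ge_const[OF int AE(1)] integral_le_const[OF int AE(2)]
    have "\<bar>(\<rho> * (ln 2 + ln 3) - ln 3) * real K\<bar> \<le> ln 12"
      by (simp add: algebra_simps abs_le_iff)
    then show ?thesis by (simp add: abs_mult)
  qed
  then have "\<bar>\<rho> * (ln 2 + ln 3) - ln 3\<bar> \<le> 0" by (rule linear_le_imp_le)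
  then show ?thesis by (simp add: \<rho>_def)
qed

section \<open>The configuration and the extreme point without invariant extension\<close>

lemma ex_distinct:
  assumes "CARD('a::finite) \<ge> 2"
  shows "\<exists>a b :: 'a. a \<noteq> b"
proof -
  have "\<not> card (UNIV :: 'a set) \<le> Suc 0" using assms by simp
  then show ?thesis by (simp add: card_le_Suc0_iff_eq)
qed

lemma ex_admissible_configuration:
  fixes p q :: "'d::finite"
  assumes "p \<noteq> q" and "CARD('s::finite) \<ge> 2"
  shows "\<exists>(x :: (int ^ 'd) \<Rightarrow> 's) s. \<forall>u j i. admissible (plane p q s (shift u x)) j i"
proof -
  obtain Y where Y: "\<And>j i. Y j i \<in> {0..1}" "\<And>j i. admissible Y j i"
    using ex_admissible_array by blast
  obtain s s' :: 's where "s \<noteq> s'"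
    using ex_distinct[OF assms(2)] by blast
  \<comment> \<open>The array is repeated constantly in the directions other than \<open>p\<close>
    and \<open>q\<close>, so every slice parallel to the plane is a translate of \<open>Y\<close>.
    Hence all shifts of \<open>x\<close> are admissible.\<close>
  define x :: "(int ^ 'd) \<Rightarrow> 's" where "x v = (if Y (v $ q) (v $ p) = 1 then s else s')" for v
  have "plane p q s (shift u x) j i = Y (u $ q + j) (u $ p + i)" for u j i
    using \<open>s \<noteq> s'\<close> \<open>p \<noteq> q\<close> Y(1)[of "u $ q + j" "u $ p + i"]
    by (auto simp: plane_def shift_def x_def axis_def)
  then have "admissible (plane p q s (shift u x)) j i" for u j i
    using Y(2)[of "u $ q + j" "u $ p + i"]
    by (subst admissible_cong[where Y' = Y and j' = "u $ q + j" and i' = "u $ p + i"])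
      (auto simp: add.assoc)
  then show ?thesis by blast
qed

theorem theorem3:
  assumes "CARD('s::finite) \<ge> 2" and "CARD('d::finite) \<ge> 2"
  shows "\<forall>\<^sub>F n in sequentially.
    \<not> (locally_invariant_measures n :: ((int ^ 'd) \<Rightarrow> 's) measure set)
        \<subseteq> marginal n ` invariant_measures \<and>
    (\<exists>\<nu> :: ((int ^ 'd) \<Rightarrow> 's) measure.
        extreme_measure \<nu> (locally_invariant_measures n) \<and>
        \<nu> \<notin> marginal n ` invariant_measures)"
proof (rule eventually_sequentiallyI)
  \<comment> \<open>From \<open>n = 12\<close> on, a cube contains every cell that the rule reads at
    the origin.\<close>
  fix n :: nat assume n: "12 \<le> n"
  obtain p q :: 'd where pq: "p \<noteq> q"
    using ex_distinct[OF assms(2)] by blast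
  obtain x :: "(int ^ 'd) \<Rightarrow> 's" and s where x: "\<And>u j i. admissible (plane p q s (shift u x)) j i"
    using ex_admissible_configuration[OF pq assms(1)] by blast
  obtain w :: "((int ^ 'd) \<Rightarrow> 's) \<Rightarrow> real"
    where w: "w \<in> balanced_weights (patterns (cube n)) (local_invariance n)"
      "\<And>b. w b \<noteq> 0 \<Longrightarrow> \<exists>u. b = restrict (shift u x) (cube n)"
    by (rule ex_empirical_weight[of n x]) blast
  obtain \<nu> :: "((int ^ 'd) \<Rightarrow> 's) measure"
    where extreme: "extreme_measure \<nu> (locally_invariant_measures n)"
      and supp: "\<And>b. measure \<nu> {b} \<noteq> 0 \<Longrightarrow> w b \<noteq> 0" and rational: "\<And>b. measure \<nu> {b} \<in> \<rat>"
    by (rule ex_extreme_rational_measure[OF w(1)]) blast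
  have \<nu>: "\<nu> \<in> locally_invariant_measures n" using extreme by (simp add: extreme_measure_def)
  have "\<nu> \<notin> marginal n ` invariant_measures"
  proof
    assume "\<nu> \<in> marginal n ` invariant_measures"
    then obtain \<mu> where \<mu>: "\<nu> = marginal n \<mu>" "\<mu> \<in> invariant_measures" by blast
    \<comment> \<open>The measure charges only patterns occurring in \<open>x\<close>, and all of
      these obey the rule at the origin.\<close>
    have "measure \<nu> {b} = 0" if "\<not> admissible (plane p q s b) 0 0" for b
    proof (rule ccontr)
      assume "measure \<nu> {b} \<noteq> 0"
      then obtain u where "b = restrict (shift u x) (cube n)" using supp w(2) by blast
      moreover have "shift 0 y = y" for y :: "(int ^ 'd) \<Rightarrow> 's" by (simp add: shift_def)
      moreover have "axis p 0 + axis q 0 = (0 :: int ^ 'd)" by (simp add: vec_eq_iff axis_def)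
      ultimately show False
        using that x[of u 0 0] admissible_plane_restrict(1)[OF pq n, of s 0 0 "shift u x"] by simp
    qed
    then have "measure \<nu> {b \<in> patterns (cube n). \<not> admissible (plane p q s b) 0 0} = 0"
      by (subst measure_eq_sum_singletons[OF \<nu>]) auto
    then have "measure \<nu> {b \<in> patterns (cube n). growing (plane p q s b) 0 0} * (ln 2 + ln 3) = ln 3"
      using growing_frequency[OF \<mu>(2) pq n] \<mu>(1) by simp
    then have "measure \<nu> {b \<in> patterns (cube n). growing (plane p q s b) 0 0} \<notin> \<rat>"
      by (rule growing_frequency_irrational)
    \<comment> \<open>The event is a finite set of patterns, each of rational mass.\<close>
    moreover have "measure \<nu> {b \<in> patterns (cube n). growing (plane p q s b) 0 0} \<in> \<rat>"
      by (subst measure_eq_sum_singletons[OF \<nu>]) (auto intro: rational Rats_sum)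
    ultimately show False by blast
  qed
  with extreme \<nu> show "\<not> (locally_invariant_measures n :: ((int ^ 'd) \<Rightarrow> 's) measure set)
        \<subseteq> marginal n ` invariant_measures \<and>
      (\<exists>\<nu> :: ((int ^ 'd) \<Rightarrow> 's) measure. extreme_measure \<nu> (locally_invariant_measures n) \<and>
        \<nu> \<notin> marginal n ` invariant_measures)"
    by blast
qed

end
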